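(* Let $\alpha$ be a nonzero complex number, $\lambda$ a complex number, and $n,k\ge 0$ integers. Then $$y_{1,\alpha}^{*}(n,k;\lambda)=\frac{1}{k!}\sum_{\ell=0}^{k}\sum_{j=0}^{\ell}S_{2,\alpha}(k,\ell)\,S_{1}(\ell,j)\,j!\,y_{1}(n,j;\lambda).$$
   Context: For an element $x$ of a commutative $\mathbb{C}$-algebra (e.g. a number or a formal power series in $t$), the degenerate falling factorial is $(x)_{0,\alpha}=1$ and $(x)_{n,\alpha}=x(x-\alpha)(x-2\alpha)\cdots(x-(n-1)\alpha)$ for $n\ge 1$. The falling factorial is $(x)_0=1$, $(x)_n=x(x-1)\cdots(x-n+1)$ for $n\ge1$. The (signed) Stirling numbers of the first kind $S_1(n,k)$ are defined by $(x)_n=\sum_{k=0}^{n}S_1(n,k)x^k$. The degenerate Stirling numbers of the second kind $S_{2,\alpha}(n,l)$ are defined by $(x)_{n,\alpha}=\sum_{l=0}^{n}S_{2,\alpha}(n,l)(x)_l$. The Simsek numbers $y_1(n,k;\lambda)$ are defined by $$\frac{(\lambda e^t+1)^k}{k!}=\sum_{n=0}^{\infty}y_1(n,k;\lambda)\frac{t^n}{n!}.$$ The new type degenerate Simsek numbers $y_{1,\alpha}^{*}(n,k;\lambda)$ are defined by $$\frac{(\lambda e^t+1)_{k,\alpha}}{k!}=\sum_{n=0}^{\infty}y_{1,\alpha}^{*}(n,k;\lambda)\frac{t^n}{n!}.$$ *)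

theory Defs
  imports "HOL-Computational_Algebra.Computational_Algebra" Complex_Main
begin

definition falling_fact :: "'a::comm_ring_1 \<Rightarrow> nat \<Rightarrow> 'a" where
  "falling_fact x n = (\<Prod>i<n. x - of_nat i)"

text \<open>
  The parameter \<open>a\<close> is the image of the scalar \<open>\<alpha>\<close> in the ring containing \<open>x\<close>: it is
  \<open>[:\<alpha>:]\<close> in the polynomial ring and \<open>fps_const \<alpha>\<close> in the ring of formal power series.
\<close>
definition deg_falling_fact :: "'a::comm_ring_1 \<Rightarrow> 'a \<Rightarrow> nat \<Rightarrow> 'a" where
  "deg_falling_fact a x n = (\<Prod>i<n. x - of_nat i * a)"

text \<open>
  The defining identities of the Stirling numbers are read as identities in the polynomial
  ring \<open>\<complex>[X]\<close>, with \<open>X = [:0, 1:]\<close>; coefficients with second index above \<open>n\<close> are zero.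
  The lemmas \<open>S1_unique\<close> and \<open>S2_deg_unique\<close> show that the descriptions determine
  the numbers.
\<close>
definition S1 :: "nat \<Rightarrow> nat \<Rightarrow> complex" where
  "S1 n = (THE c. (\<forall>k>n. c k = 0) \<and>
     falling_fact [:0, 1:] n = (\<Sum>k\<le>n. smult (c k) ([:0, 1:] ^ k)))"

definition S2_deg :: "complex \<Rightarrow> nat \<Rightarrow> nat \<Rightarrow> complex" where
  "S2_deg \<alpha> n = (THE c. (\<forall>l>n. c l = 0) \<and>
     deg_falling_fact [:\<alpha>:] [:0, 1:] n = (\<Sum>l\<le>n. smult (c l) (falling_fact [:0, 1:] l)))"

definition simsek_y1 :: "nat \<Rightarrow> nat \<Rightarrow> complex \<Rightarrow> complex" where
  "simsek_y1 n k lam =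
     fact n * fps_nth (fps_const (1 / fact k) * (fps_const lam * fps_exp 1 + 1) ^ k) n"

definition deg_simsek_y1 :: "complex \<Rightarrow> nat \<Rightarrow> nat \<Rightarrow> complex \<Rightarrow> complex" where
  "deg_simsek_y1 \<alpha> n k lam =
     fact n * fps_nth (fps_const (1 / fact k) *
       deg_falling_fact (fps_const \<alpha>) (fps_const lam * fps_exp 1 + 1) k) n"

lemma simsek_y1_egf:
  "fps_const (1 / fact k) * (fps_const lam * fps_exp 1 + 1) ^ k =
     Abs_fps (\<lambda>n. simsek_y1 n k lam / fact n)"
  by (rule fps_ext) (simp add: simsek_y1_def)

lemma deg_simsek_y1_egf:
  "fps_const (1 / fact k) * deg_falling_fact (fps_const \<alpha>) (fps_const lam * fps_exp 1 + 1) k =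
     Abs_fps (\<lambda>n. deg_simsek_y1 \<alpha> n k lam / fact n)"
  by (rule fps_ext) (simp add: deg_simsek_y1_def)

lemma graded_basis_exists:
  fixes b :: "nat \<Rightarrow> 'a::field poly"
  assumes deg: "\<And>l. degree (b l) = l" and nz: "\<And>l. b l \<noteq> 0"
  shows "degree p \<le> n \<Longrightarrow> \<exists>c. (\<forall>l>n. c l = 0) \<and> p = (\<Sum>l\<le>n. smult (c l) (b l))"
proof (induction n arbitrary: p)
  case 0
  have b0: "coeff (b 0) 0 \<noteq> 0" using deg[of 0] nz[of 0] leading_coeff_0_iff by metis
  have "p = smult (coeff p 0 / coeff (b 0) 0) (b 0)"
  proof (rule poly_eqI)
    fix i show "coeff p i = coeff (smult (coeff p 0 / coeff (b 0) 0) (b 0)) i"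
      using 0 b0 deg[of 0] by (cases i) (auto simp: coeff_eq_0)
  qed
  then show ?case
    by (intro exI[of _ "\<lambda>l. if l = 0 then coeff p 0 / coeff (b 0) 0 else 0"]) auto
next
  case (Suc n)
  define a where "a = coeff p (Suc n) / coeff (b (Suc n)) (Suc n)"
  define q where "q = p - smult a (b (Suc n))"
  have bn: "coeff (b (Suc n)) (Suc n) \<noteq> 0"
    using deg[of "Suc n"] nz[of "Suc n"] leading_coeff_0_iff by metis
  have "degree q \<le> n"
  proof (rule degree_le, intro allI impI)
    fix i assume "n < i"
    then consider "i = Suc n" | "i > Suc n" by linarith
    then show "coeff q i = 0"
      using Suc.prems bn deg[of "Suc n"] by cases (auto simp: q_def a_def coeff_eq_0)
  qed
  then obtain c where c: "\<forall>l>n. c l = 0" "q = (\<Sum>l\<le>n. smult (c l) (b l))"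
    using Suc.IH by blast
  have "p = q + smult a (b (Suc n))" by (simp add: q_def)
  then show ?case using c
    by (intro exI[of _ "c(Suc n := a)"]) auto
qed

lemma graded_basis_independent:
  fixes b :: "nat \<Rightarrow> 'a::field poly"
  assumes deg: "\<And>l. degree (b l) = l" and nz: "\<And>l. b l \<noteq> 0"
  shows "(\<Sum>l\<le>n. smult (d l) (b l)) = 0 \<Longrightarrow> l \<le> n \<Longrightarrow> d l = 0"
proof (induction n arbitrary: l)
  case 0 then show ?case using nz[of 0] by simp
next
  case (Suc n)
  have "coeff (\<Sum>l\<le>n. smult (d l) (b l)) (Suc n) = 0"
    using deg by (simp add: coeff_sum coeff_eq_0)
  then have "d (Suc n) * coeff (b (Suc n)) (Suc n) = 0"
    using arg_cong[OF Suc.prems(1), of "\<lambda>p. coeff p (Suc n)"] by simp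
  moreover have "coeff (b (Suc n)) (Suc n) \<noteq> 0"
    using deg[of "Suc n"] nz[of "Suc n"] leading_coeff_0_iff by metis
  ultimately have d: "d (Suc n) = 0" by simp
  then show ?case using Suc by (cases "l = Suc n") auto
qed

lemma graded_basis_unique:
  fixes b :: "nat \<Rightarrow> 'a::field poly"
  assumes "\<And>l. degree (b l) = l" and "\<And>l. b l \<noteq> 0" and "degree p \<le> n"
  shows "\<exists>!c. (\<forall>l>n. c l = 0) \<and> p = (\<Sum>l\<le>n. smult (c l) (b l))"
proof (rule ex_ex1I)
  show "\<exists>c. (\<forall>l>n. c l = 0) \<and> p = (\<Sum>l\<le>n. smult (c l) (b l))"
    using graded_basis_exists[of b] assms by blast
next
  fix c d
  assume c: "(\<forall>l>n. c l = 0) \<and> p = (\<Sum>l\<le>n. smult (c l) (b l))"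
    and d: "(\<forall>l>n. d l = 0) \<and> p = (\<Sum>l\<le>n. smult (d l) (b l))"
  then have "(\<Sum>l\<le>n. smult (c l - d l) (b l)) = 0"
    by (simp add: smult_diff_left sum_subtractf)
  then have "c l - d l = 0" if "l \<le> n" for l
    using graded_basis_independent[of b "\<lambda>l. c l - d l" n l] assms that by blast
  then show "c = d" using c d by (intro ext) (metis eq_iff_diff_eq_0 not_le)
qed

lemma deg_falling_fact_poly:
  "degree (deg_falling_fact [:a:] [:0, 1 :: complex:] n) = n \<and>
   deg_falling_fact [:a:] [:0, 1 :: complex:] n \<noteq> 0"
proof -
  have f: "[:0, 1:] - of_nat i * [:a:] = [:- (of_nat i * a), 1:]" for i
    by (simp add: of_nat_poly)
  show ?thesis
    unfolding deg_falling_fact_def f by (simp add: degree_prod_eq_sum_degree)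
qed

lemma falling_fact_eq_deg: "falling_fact x n = deg_falling_fact 1 x n"
  by (simp add: falling_fact_def deg_falling_fact_def)

lemma falling_fact_poly:
  "degree (falling_fact [:0, 1 :: complex:] n) = n \<and> falling_fact [:0, 1 :: complex:] n \<noteq> 0"
  using deg_falling_fact_poly[of 1 n] by (simp add: falling_fact_eq_deg one_pCons)

lemma S1_unique:
  "\<exists>!c :: nat \<Rightarrow> complex. (\<forall>k>n. c k = 0) \<and>
     falling_fact [:0, 1:] n = (\<Sum>k\<le>n. smult (c k) ([:0, 1:] ^ k))"
  by (rule graded_basis_unique) (auto simp: degree_power_eq falling_fact_poly)

lemma S2_deg_unique:
  "\<exists>!c :: nat \<Rightarrow> complex. (\<forall>l>n. c l = 0) \<and>
     deg_falling_fact [:\<alpha>:] [:0, 1:] n = (\<Sum>l\<le>n. smult (c l) (falling_fact [:0, 1:] l))"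
  by (rule graded_basis_unique) (auto simp: deg_falling_fact_poly falling_fact_poly)

lemma S1_expansion:
  "falling_fact [:0, 1:] n = (\<Sum>k\<le>n. smult (S1 n k) ([:0, 1:] ^ k))"
  using theI'[OF S1_unique[of n]] unfolding S1_def by blast

lemma S2_deg_expansion:
  "deg_falling_fact [:\<alpha>:] [:0, 1:] n = (\<Sum>l\<le>n. smult (S2_deg \<alpha> n l) (falling_fact [:0, 1:] l))"
  using theI'[OF S2_deg_unique[of n \<alpha>]] unfolding S2_deg_def by blast

end

theory Submission
  imports Defs
begin

text \<open>
  The defining identities of the two families of Stirling numbers are polynomial identities, so
  they can be evaluated at the power series \<open>\<lambda> e\<^sup>t + 1\<close>, because evaluation is a homomorphism
  of \<open>\<complex>\<close>-algebras. Substituting one expansion into the other writes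
  \<open>(\<lambda> e\<^sup>t + 1)\<^bsub>k,\<alpha>\<^esub>\<close> in terms of the powers \<open>(\<lambda> e\<^sup>t + 1)\<^sup>j\<close>, whose coefficients are
  Simsek numbers.
\<close>

text \<open>Embedding the scalar coefficients as constant series lets \<open>poly\<close> evaluate
  within the ring of power series.\<close>

definition fps_eval :: "'a::comm_ring_1 fps \<Rightarrow> 'a poly \<Rightarrow> 'a fps" where
  "fps_eval x p = poly (map_poly fps_const p) x"

lemma fps_eval_pCons [simp]: "fps_eval x (pCons a p) = fps_const a + x * fps_eval x p"
  by (simp add: fps_eval_def map_poly_pCons)

lemma fps_eval_0 [simp]: "fps_eval x 0 = 0"
  by (simp add: fps_eval_def)

lemma fps_eval_1 [simp]: "fps_eval x 1 = 1"
  by (simp add: one_pCons)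

lemma fps_eval_add [simp]: "fps_eval x (p + q) = fps_eval x p + fps_eval x q"
  by (induction p q rule: poly_induct2)
    (simp_all add: algebra_simps flip: fps_const_add)

lemma fps_eval_smult [simp]: "fps_eval x (smult c p) = fps_const c * fps_eval x p"
  by (induction p) (simp_all add: algebra_simps flip: fps_const_mult)

lemma fps_eval_mult [simp]: "fps_eval x (p * q) = fps_eval x p * fps_eval x q"
  by (induction p) (simp_all add: algebra_simps)

lemma fps_eval_power [simp]: "fps_eval x (p ^ n) = fps_eval x p ^ n"
  by (induction n) simp_all

lemma fps_eval_sum [simp]: "fps_eval x (\<Sum>i\<in>A. p i) = (\<Sum>i\<in>A. fps_eval x (p i))"
  by (induction A rule: infinite_finite_induct) simp_all

lemma fps_eval_prod [simp]: "fps_eval x (\<Prod>i\<in>A. p i) = (\<Prod>i\<in>A. fps_eval x (p i))"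
  by (induction A rule: infinite_finite_induct) simp_all

lemma fps_eval_deg_falling_fact:
  "fps_eval x (deg_falling_fact [:a:] [:0, 1:] n) = deg_falling_fact (fps_const a) x n"
proof -
  \<comment> \<open>As an explicit linear polynomial, each factor is evaluated by
    \<open>fps_eval_pCons\<close>.\<close>
  have "[:0, 1:] - of_nat i * [:a:] = [:- (of_nat i * a), 1:]" for i
    by (simp add: of_nat_poly)
  then show ?thesis
    by (simp add: deg_falling_fact_def fps_of_nat flip: fps_const_neg fps_const_mult)
qed

lemma deg_falling_fact_fps_expansion:
  "deg_falling_fact (fps_const \<alpha>) x k =
     (\<Sum>l\<le>k. \<Sum>j\<le>l. fps_const (S2_deg \<alpha> k l * S1 l j) * x ^ j)"
proof -
  have "deg_falling_fact (fps_const \<alpha>) x k = fps_eval x (deg_falling_fact [:\<alpha>:] [:0, 1:] k)"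
    by (simp only: fps_eval_deg_falling_fact)
  also have "\<dots> = (\<Sum>l\<le>k. \<Sum>j\<le>l. fps_const (S2_deg \<alpha> k l * S1 l j) * x ^ j)"
    by (simp add: S2_deg_expansion S1_expansion sum_distrib_left mult.assoc
        flip: fps_const_mult)
  finally show ?thesis .
qed

theorem theorem2p7:
  fixes \<alpha> lam :: complex and n k :: nat
  assumes "\<alpha> \<noteq> 0"
  shows "deg_simsek_y1 \<alpha> n k lam =
    1 / fact k * (\<Sum>l=0..k. \<Sum>j=0..l. S2_deg \<alpha> k l * S1 l j * fact j * simsek_y1 n j lam)"
  \<comment> \<open>The factor \<open>fact j\<close> cancels the \<open>1 / fact j\<close> inside
    \<open>simsek_y1 n j lam\<close>, leaving \<open>fact n\<close> times the \<open>n\<close>-th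
    coefficient of the \<open>j\<close>-th power; then coefficients are compared.\<close>
  by (simp add: deg_simsek_y1_def simsek_y1_def deg_falling_fact_fps_expansion fps_sum_nth
      sum_distrib_left atMost_atLeast0 mult_ac)

end
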